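(* Let $|\Phi\rangle \in \mathbb{C}^2\otimes\mathbb{C}^2$ be a normalized pure two-qubit state, and let $|\Phi\rangle\otimes|0\rangle$ be the input state of the swap test circuit. Let $\mathbb{P}(1)_\Phi$ be the probability of measuring the ancilla qubit in the state $|1\rangle$ at the output of the circuit. If $\mathbb{P}(1)_\Phi > \frac12$, then $|\Phi\rangle$ is entangled.
   Context: The swap test circuit acts on $\mathbb{C}^2\otimes\mathbb{C}^2\otimes\mathbb{C}^2$. The first two factors are the target qubits and the third is the ancilla. The circuit implements the unitary $U_{\mathrm{SWAP}} = (\mathbb{1}\otimes H)\, U_{\mathrm{CSWAP}}\, (\mathbb{1}\otimes H)$, where: - $\mathbb{1}$ is the identity on $\mathbb{C}^2\otimes\mathbb{C}^2$; - $H=\frac{1}{\sqrt2}\begin{pmatrix}1&1\\1&-1\end{pmatrix}$ is the Hadamard gate, acting on the ancilla; - $U_{\mathrm{CSWAP}}=\mathbb{1}\otimes|0\rangle\langle 0| + S\otimes |1\rangle\langle 1|$, with $S$ the swap operator $S(|u\rangle\otimes|v\rangle)=|v\rangle\otimes|u\rangle$ on $\mathbb{C}^2\otimes\mathbb{C}^2$. The probability is $\mathbb{P}(1)_\Phi = \mathrm{Tr}\left[(\mathbb{1}\otimes|1\rangle\langle1|)\,U_{\mathrm{SWAP}}(|\Phi\rangle\langle\Phi|\otimes|0\rangle\langle0|)U_{\mathrm{SWAP}}^\dagger\right]$. A pure state is entangled if it is not a product state $|\psi\rangle\otimes|\xi\rangle$ with $|\psi\rangle,|\xi\rangle\in\mathbb{C}^2$.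 *)

theory Defs
  imports "HOL-Analysis.Analysis"
begin

text \<open>
  Finite-dimensional state spaces are represented in the computational basis.  A qubit is a vector
  of type \<open>complex ^ 2\<close>, whose index type has exactly the elements \<open>0\<close> and \<open>1\<close>; the tensor product
  of spaces with index types \<open>'a\<close> and \<open>'b\<close> is the space with index type \<open>'a \<times> 'b\<close>.  Indices are
  always written \<open>0\<close> and \<open>1\<close>: in the type \<open>2\<close> the numeral \<open>2\<close> denotes \<open>0\<close>, so the library's
  \<open>vector [x, y]\<close> would list the coordinates in the wrong order.
\<close>

type_synonym qubit = "complex ^ 2"
type_synonym two_qubit = "complex ^ (2 \<times> 2)"

definition tensor_vec :: "complex ^ 'a \<Rightarrow> complex ^ 'b \<Rightarrow> complex ^ ('a \<times> 'b)"
    (infixl \<open>\<otimes>\<^sub>v\<close> 70) where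
  "u \<otimes>\<^sub>v v = (\<chi> p. u $ fst p * v $ snd p)"

definition tensor_mat ::
    "complex ^ 'a ^ 'c \<Rightarrow> complex ^ 'b ^ 'd \<Rightarrow> complex ^ ('a \<times> 'b) ^ ('c \<times> 'd)"
    (infixl \<open>\<otimes>\<^sub>m\<close> 75) where
  "A \<otimes>\<^sub>m B = (\<chi> p q. A $ fst p $ fst q * B $ snd p $ snd q)"

definition adjoint_mat :: "complex ^ 'a ^ 'b \<Rightarrow> complex ^ 'b ^ 'a" where
  "adjoint_mat A = (\<chi> i j. cnj (A $ j $ i))"

definition ket_bra :: "complex ^ 'a \<Rightarrow> complex ^ 'b \<Rightarrow> complex ^ 'b ^ 'a" where
  "ket_bra u v = (\<chi> i j. u $ i * cnj (v $ j))"

definition ket :: "2 \<Rightarrow> qubit" where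
  "ket b = axis b 1"

definition hadamard :: "complex ^ 2 ^ 2" where
  "hadamard = (\<chi> i j. (if i = 1 \<and> j = 1 then - 1 else 1) / complex_of_real (sqrt 2))"

definition swap_op :: "complex ^ (2 \<times> 2) ^ (2 \<times> 2)" where
  "swap_op = (\<chi> p q. if p = prod.swap q then 1 else 0)"

definition cswap :: "complex ^ ((2 \<times> 2) \<times> 2) ^ ((2 \<times> 2) \<times> 2)" where
  "cswap = mat 1 \<otimes>\<^sub>m ket_bra (ket 0) (ket 0) + swap_op \<otimes>\<^sub>m ket_bra (ket 1) (ket 1)"

definition swap_test :: "complex ^ ((2 \<times> 2) \<times> 2) ^ ((2 \<times> 2) \<times> 2)" where
  "swap_test = (mat 1 \<otimes>\<^sub>m hadamard) ** cswap ** (mat 1 \<otimes>\<^sub>m hadamard)"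

definition swap_test_trace :: "two_qubit \<Rightarrow> complex" where
  "swap_test_trace \<Phi> =
     trace ((mat 1 \<otimes>\<^sub>m ket_bra (ket 1) (ket 1)) **
       (swap_test ** (ket_bra \<Phi> \<Phi> \<otimes>\<^sub>m ket_bra (ket 0) (ket 0)) ** adjoint_mat swap_test))"

text \<open>The trace is a real number; see \<open>of_real_prob_one\<close> below.\<close>

definition prob_one :: "two_qubit \<Rightarrow> real" where
  "prob_one \<Phi> = Re (swap_test_trace \<Phi>)"

definition product_state :: "two_qubit \<Rightarrow> bool" where
  "product_state \<Phi> \<longleftrightarrow> (\<exists>(\<psi> :: qubit) (\<xi> :: qubit). \<Phi> = \<psi> \<otimes>\<^sub>v \<xi>)"

definition entangled :: "two_qubit \<Rightarrow> bool" where
  "entangled \<Phi> \<longleftrightarrow> \<not> product_state \<Phi>"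

lemma swap_op_tensor_vec: "swap_op *v (u \<otimes>\<^sub>v v) = v \<otimes>\<^sub>v u"
proof -
  have "p = prod.swap q \<longleftrightarrow> q = prod.swap p" for p q :: "2 \<times> 2"
    by (cases p; cases q) auto
  then show ?thesis
    by (simp add: vec_eq_iff matrix_vector_mult_def swap_op_def tensor_vec_def
        if_distrib[of "\<lambda>x. x * _"] sum.delta cong: if_cong)
qed

lemma tensor_mat_mult_vec: "(A \<otimes>\<^sub>m B) *v (u \<otimes>\<^sub>v v) = (A *v u) \<otimes>\<^sub>v (B *v v)"
  by (simp add: vec_eq_iff matrix_vector_mult_def tensor_vec_def tensor_mat_def
      sum_product sum.cartesian_product UNIV_Times_UNIV[symmetric] split_beta mult_ac
      del: UNIV_Times_UNIV)

lemma trace_projector_conj_real: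
  fixes P \<rho> U :: "complex ^ 'n ^ 'n"
  assumes "adjoint_mat P = P" "adjoint_mat \<rho> = \<rho>"
  shows "cnj (trace (P ** (U ** \<rho> ** adjoint_mat U))) = trace (P ** (U ** \<rho> ** adjoint_mat U))"
proof -
  have cnj_trace: "cnj (trace A) = trace (adjoint_mat A)" for A :: "complex ^ 'n ^ 'n"
    by (simp add: trace_def adjoint_mat_def)
  have mult: "adjoint_mat (A ** B) = adjoint_mat B ** adjoint_mat A"
    for A B :: "complex ^ 'n ^ 'n"
    by (simp add: vec_eq_iff adjoint_mat_def matrix_matrix_mult_def mult.commute)
  have adj: "adjoint_mat (adjoint_mat A) = A" for A :: "complex ^ 'n ^ 'n"
    by (simp add: vec_eq_iff adjoint_mat_def)
  let ?M = "U ** \<rho> ** adjoint_mat U"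
  have "adjoint_mat ?M = ?M"
    by (simp add: mult adj assms matrix_mul_assoc)
  then have "cnj (trace (P ** ?M)) = trace (?M ** P)"
    by (simp only: cnj_trace mult assms)
  then show ?thesis
    by (metis trace_mul_sym)
qed

lemma of_real_prob_one: "complex_of_real (prob_one \<Phi>) = swap_test_trace \<Phi>"
proof -
  have adj_tensor: "adjoint_mat (A \<otimes>\<^sub>m B) = adjoint_mat A \<otimes>\<^sub>m adjoint_mat B"
    for A :: "complex ^ 'a ^ 'c" and B :: "complex ^ 'b ^ 'd"
    by (simp add: vec_eq_iff adjoint_mat_def tensor_mat_def)
  have adj_ket_bra: "adjoint_mat (ket_bra u u) = ket_bra u u" for u :: "complex ^ 'a"
    by (simp add: vec_eq_iff adjoint_mat_def ket_bra_def mult.commute)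
  have adj_one: "adjoint_mat (mat 1) = (mat 1 :: complex ^ 'a ^ 'a)"
    by (simp add: vec_eq_iff adjoint_mat_def mat_def)
  have "cnj (swap_test_trace \<Phi>) = swap_test_trace \<Phi>"
    unfolding swap_test_trace_def
    by (rule trace_projector_conj_real) (simp_all add: adj_tensor adj_ket_bra adj_one)
  then show ?thesis
    by (simp add: prob_one_def complex_eq_iff)
qed

end

theory Submission
  imports Defs
begin

text \<open>
  The circuit maps \<open>\<Phi> \<otimes> |0\<rangle>\<close> to \<open>1/2 (\<Phi> + S \<Phi>) \<otimes> |0\<rangle> + 1/2 (\<Phi> - S \<Phi>) \<otimes> |1\<rangle>\<close>, so for a
  normalized state the probability of the outcome \<open>1\<close> is
  \<open>1/4 \<parallel>\<Phi> - S \<Phi>\<parallel>\<^sup>2 = 1/2 (1 - \<langle>\<Phi>, S \<Phi>\<rangle>)\<close>.  On a product state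
  \<open>\<langle>u \<otimes> v, S (u \<otimes> v)\<rangle> = |\<langle>u, v\<rangle>|\<^sup>2 \<ge> 0\<close>, hence the probability is at most \<open>1/2\<close>.
\<close>

text \<open>Together with the next two rules this keeps a pure state in rank-one form, so the
  operator inside \<open>swap_test_trace\<close> reduces to matrices acting on vectors.\<close>

lemma tensor_mat_ket_bra: "ket_bra u v \<otimes>\<^sub>m ket_bra x y = ket_bra (u \<otimes>\<^sub>v x) (v \<otimes>\<^sub>v y)"
  by (simp add: vec_eq_iff tensor_mat_def ket_bra_def tensor_vec_def)

lemma mult_ket_bra: "A ** ket_bra u v = ket_bra (A *v u) v"
  by (simp add: vec_eq_iff matrix_matrix_mult_def matrix_vector_mult_def ket_bra_def
      sum_distrib_right mult.assoc)

lemma ket_bra_mult_adjoint: "ket_bra u v ** adjoint_mat A = ket_bra u (A *v v)"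
  by (simp add: vec_eq_iff matrix_matrix_mult_def matrix_vector_mult_def ket_bra_def
      adjoint_mat_def sum_distrib_left mult_ac)

lemma trace_ket_bra: "trace (ket_bra u v) = (\<Sum>i\<in>UNIV. u $ i * cnj (v $ i))"
  by (simp add: trace_def ket_bra_def)

text \<open>The type class inner product is real-valued: it is the real part of the Hermitian one,
  matching the \<open>Re\<close> in \<open>prob_one\<close>.\<close>

lemma inner_eq_Re_cnj: "x \<bullet> y = Re (\<Sum>i\<in>UNIV. x $ i * cnj (y $ i))" for x y :: "complex ^ 'n"
  by (simp add: inner_vec_def inner_complex_def)

lemma tensor_vec_add_left: "(u + v) \<otimes>\<^sub>v w = u \<otimes>\<^sub>v w + v \<otimes>\<^sub>v w"
  by (simp add: vec_eq_iff tensor_vec_def algebra_simps)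

lemma tensor_vec_diff_left: "(u - v) \<otimes>\<^sub>v w = u \<otimes>\<^sub>v w - v \<otimes>\<^sub>v w"
  by (simp add: vec_eq_iff tensor_vec_def algebra_simps)

lemma tensor_vec_add_right: "u \<otimes>\<^sub>v (v + w) = u \<otimes>\<^sub>v v + u \<otimes>\<^sub>v w"
  by (simp add: vec_eq_iff tensor_vec_def algebra_simps)

lemma tensor_vec_diff_right: "u \<otimes>\<^sub>v (v - w) = u \<otimes>\<^sub>v v - u \<otimes>\<^sub>v w"
  by (simp add: vec_eq_iff tensor_vec_def algebra_simps)

lemma tensor_vec_scale_right: "u \<otimes>\<^sub>v (c *s v) = c *s (u \<otimes>\<^sub>v v)"
  by (simp add: vec_eq_iff tensor_vec_def algebra_simps)

lemma tensor_vec_zero_right: "u \<otimes>\<^sub>v 0 = 0"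
  by (simp add: vec_eq_iff tensor_vec_def)

text \<open>\<open>exhaust_2\<close> offers the cases \<open>1\<close> and \<open>2\<close>; in the
  index type the latter is \<open>0\<close>.\<close>

lemma qubit_index_eq_1_iff: "i = 1 \<longleftrightarrow> i \<noteq> 0" for i :: 2
proof -
  have "(2 :: 2) = 0"
    by simp
  then show ?thesis
    using exhaust_2[of i] by auto
qed

lemma UNIV_qubit_index: "(UNIV :: 2 set) = {0, 1}"
  by (auto simp: qubit_index_eq_1_iff)

lemma hadamard_ket:
  "hadamard *v ket 0 = (1 / complex_of_real (sqrt 2)) *s (ket 0 + ket 1)"
  "hadamard *v ket 1 = (1 / complex_of_real (sqrt 2)) *s (ket 0 - ket 1)"
  by (auto simp: vec_eq_iff hadamard_def ket_def matrix_vector_mult_def axis_def UNIV_qubit_index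
      qubit_index_eq_1_iff)

lemma ket_bra_mult_ket: "ket_bra (ket a) (ket a) *v ket b = (if a = b then ket b else 0)"
  by (auto simp: vec_eq_iff ket_bra_def ket_def matrix_vector_mult_def axis_def
      if_distrib[of cnj] if_distrib[of "\<lambda>x. x * _"] cong: if_cong)

text \<open>A basis state of the ancilla is annihilated by one of the two projectors in
  \<open>cswap\<close>, so a single summand survives.\<close>

lemma cswap_mult_ket:
  "cswap *v (\<Phi> \<otimes>\<^sub>v ket 0) = \<Phi> \<otimes>\<^sub>v ket 0"
  "cswap *v (\<Phi> \<otimes>\<^sub>v ket 1) = (swap_op *v \<Phi>) \<otimes>\<^sub>v ket 1"
  by (simp_all add: cswap_def matrix_vector_mult_add_rdistrib tensor_mat_mult_vec
      ket_bra_mult_ket tensor_vec_zero_right)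

lemma swap_test_mult_ket_0:
  "swap_test *v (\<Phi> \<otimes>\<^sub>v ket 0) =
     (1 / 2) *s ((\<Phi> + swap_op *v \<Phi>) \<otimes>\<^sub>v ket 0 + (\<Phi> - swap_op *v \<Phi>) \<otimes>\<^sub>v ket 1)"
proof -
  \<comment> \<open>Each of the two Hadamard layers contributes one factor 1 / sqrt 2.\<close>
  have half: "1 / complex_of_real (sqrt 2) * (1 / complex_of_real (sqrt 2)) = 1 / 2"
    by (simp flip: of_real_mult)
  show ?thesis
    by (simp add: swap_test_def matrix_vector_mul_assoc[symmetric] tensor_mat_mult_vec hadamard_ket
        tensor_vec_scale_right tensor_vec_add_right tensor_vec_diff_right tensor_vec_add_left
        tensor_vec_diff_left matrix_vector_right_distrib vector_scalar_commute cswap_mult_ket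
        vector_add_ldistrib vector_ssub_ldistrib vector_smult_assoc half
        del: times_divide_eq_left times_divide_eq_right)
qed

lemma prob_one_eq: "prob_one \<Phi> = (norm (\<Phi> - swap_op *v \<Phi>))\<^sup>2 / 4"
proof -
  define a where "a = \<Phi> + swap_op *v \<Phi>"
  define b where "b = \<Phi> - swap_op *v \<Phi>"
  let ?w = "(1 / 2) *s (a \<otimes>\<^sub>v ket 0 + b \<otimes>\<^sub>v ket 1)"
  have "(mat 1 \<otimes>\<^sub>m ket_bra (ket 1) (ket 1)) *v ?w = (1 / 2) *s (b \<otimes>\<^sub>v ket 1)"
    by (simp add: vector_scalar_commute matrix_vector_right_distrib tensor_mat_mult_vec
        ket_bra_mult_ket tensor_vec_zero_right)
  then have "swap_test_trace \<Phi> = trace (ket_bra ((1 / 2) *s (b \<otimes>\<^sub>v ket 1)) ?w)"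
    by (simp add: swap_test_trace_def tensor_mat_ket_bra mult_ket_bra ket_bra_mult_adjoint
        swap_test_mult_ket_0 a_def b_def)
  \<comment> \<open>The ket is supported on ancilla value 1, so the \<open>a\<close> part of
    \<open>?w\<close> drops out of the trace; the prefactors of ket and bra multiply to 1/4.\<close>
  also have "\<dots> = (\<Sum>i\<in>UNIV. b $ i * cnj (b $ i)) / 4"
    by (simp add: trace_ket_bra UNIV_Times_UNIV[symmetric] sum.cartesian_product[symmetric]
        UNIV_qubit_index tensor_vec_def ket_def axis_def sum_divide_distrib del: UNIV_Times_UNIV)
  finally have "prob_one \<Phi> = (b \<bullet> b) / 4"
    by (simp only: prob_one_def inner_eq_Re_cnj Re_divide_numeral)
  then show ?thesis
    by (simp add: b_def power2_norm_eq_inner)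
qed

lemma norm_tensor_vec: "norm (u \<otimes>\<^sub>v v) = norm u * norm v"
proof -
  \<comment> \<open>Squaring removes the roots, and the sum over pairs of indices
    factorizes.\<close>
  have "(norm (u \<otimes>\<^sub>v v))\<^sup>2 = (norm u * norm v)\<^sup>2"
    by (simp add: norm_vec_def L2_set_def tensor_vec_def norm_mult power_mult_distrib sum_nonneg
        sum_product sum.cartesian_product UNIV_Times_UNIV[symmetric] split_beta
        del: UNIV_Times_UNIV)
  then show ?thesis
    by (simp add: power2_eq_iff_nonneg)
qed

text \<open>The sum over index pairs factorizes into \<open>?s\<close> from the first tensor factor
  and its conjugate from the second.\<close>

lemma inner_tensor_vec_swap: "(u \<otimes>\<^sub>v v) \<bullet> (v \<otimes>\<^sub>v u) = (cmod (\<Sum>i\<in>UNIV. u $ i * cnj (v $ i)))\<^sup>2"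
proof -
  let ?s = "\<Sum>i\<in>UNIV. u $ i * cnj (v $ i)"
  have "(\<Sum>p\<in>UNIV. (u \<otimes>\<^sub>v v) $ p * cnj ((v \<otimes>\<^sub>v u) $ p)) = ?s * cnj ?s"
    by (simp add: tensor_vec_def sum_product sum.cartesian_product UNIV_Times_UNIV[symmetric]
        split_beta mult_ac del: UNIV_Times_UNIV)
  then show ?thesis
    by (simp add: inner_eq_Re_cnj complex_norm_square[symmetric] del: Re_sum cnj_sum)
qed

theorem theorem1:
  fixes \<Phi> :: two_qubit
  assumes "norm \<Phi> = 1"
    and "prob_one \<Phi> > 1 / 2"
  shows "entangled \<Phi>"
  unfolding entangled_def
proof
  assume "product_state \<Phi>"
  then obtain u v :: qubit where \<Phi>: "\<Phi> = u \<otimes>\<^sub>v v"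
    by (auto simp: product_state_def)
  have "norm (v \<otimes>\<^sub>v u) = 1"
    using assms(1) by (simp add: \<Phi> norm_tensor_vec mult.commute)
  \<comment> \<open>Polarization (\<open>dot_norm_neg\<close>) for two unit vectors.\<close>
  then have "(norm (\<Phi> - swap_op *v \<Phi>))\<^sup>2 = 2 - 2 * (\<Phi> \<bullet> (v \<otimes>\<^sub>v u))"
    using assms(1) by (simp add: \<Phi> swap_op_tensor_vec dot_norm_neg field_simps)
  also have "\<dots> \<le> 2"
    by (simp add: \<Phi> inner_tensor_vec_swap)
  finally show False
    using assms(2) by (simp add: prob_one_eq)
qed

end
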